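(* Let $w:\mathbb{R}\to[0,\infty)$ be a weight function with finite moments of every order and $\int_{\mathbb{R}}w(x)\,dx>0$. There exists exactly one system of monic polynomials $\varphi_i(x)$, $i\ge0$, with $\deg\varphi_i=i$, such that for some constants $\sigma_k>0$ ($k\ge0$) and $\gamma_i>0$ ($i\ge0$ even), $$\biggl(\int_{x<y}-\int_{x>y}\biggr)\varphi_i(x)\varphi_j(y)w(x)w(y)\,dx\,dy=\begin{cases}\sigma_k&(i,j)=(2k,2k+1),\\-\sigma_k&(i,j)=(2k+1,2k),\\0&\text{otherwise},\end{cases}$$ and $$\int_{\mathbb{R}}\varphi_i(x)w(x)\,dx=\begin{cases}\gamma_i&(i\text{ even}),\\0&(i\text{ odd}).\end{cases}$$
   Context: All polynomials have real coefficients. "Monic" means leading coefficient $1$. *)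

theory Defs
  imports "HOL-Analysis.Analysis" "HOL-Computational_Algebra.Polynomial"
begin

text \<open>
  \<open>lebesgue\<close> at type \<^typ>\<open>(real \<times> real) measure\<close> is two-dimensional (completed) Lebesgue measure.
  Under finite moments of a measurable \<open>w\<close> both integrands are integrable, so no
  default value of the Bochner integral is involved.
\<close>

definition skew_form :: "(real \<Rightarrow> real) \<Rightarrow> real poly \<Rightarrow> real poly \<Rightarrow> real" where
  "skew_form w p q =
     (LINT z:{(x, y). x < y}|lebesgue. poly p (fst z) * poly q (snd z) * w (fst z) * w (snd z))
   - (LINT z:{(x, y). x > y}|lebesgue. poly p (fst z) * poly q (snd z) * w (fst z) * w (snd z))"

end

theory Submission
  imports Defs
begin

text \<open>
  Write the skew form as \<open>\<langle>p, q\<rangle> = \<integral> q w G\<close> with \<open>G(y) = \<integral> sgn(y - x) p(x) w(x) dx\<close>. Since \<open>G' = 2 p w\<close>,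
  \<open>G\<close> is monotone between consecutive roots of \<open>p\<close>, so for \<open>p\<close> monic of degree \<open>d\<close> it changes
  sign at most \<open>d + 1\<close> times, and at most \<open>d\<close> times if \<open>G(\<infinity>) = \<integral> p w \<le> 0\<close>. The monic polynomial \<open>q\<close>
  vanishing at the sign changes satisfies \<open>\<langle>p, q\<rangle> \<noteq> 0\<close>, with \<open>\<langle>p, q\<rangle> > 0\<close> if \<open>\<integral> p w > 0\<close>.
  Hence a monic \<open>p\<close> of degree \<open>2k\<close> orthogonal to all lower degrees, and so also to itself, has
  \<open>\<integral> p w > 0\<close>, its \<open>q\<close> has degree exactly \<open>2k + 1\<close>, and \<open>\<langle>p, q\<rangle>\<close> is \<open>\<sigma>\<^sub>k > 0\<close>. This lets skew
  Gram-Schmidt run without ever degenerating; the normalisation \<open>\<integral> \<phi>\<^sub>i w = 0\<close> for odd \<open>i\<close> removes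
  the freedom of adding a multiple of \<open>\<phi>\<^bsub>2k\<^esub>\<close> to \<open>\<phi>\<^bsub>2k+1\<^esub>\<close>.
\<close>

section \<open>Skew Gram-Schmidt\<close>

text \<open>Vanishing coefficients rather than a bound on \<open>degree\<close>: the set is then
  closed under linear operations, and for \<open>n = 0\<close> it still contains the zero
  polynomial.\<close>

definition polys_below :: "nat \<Rightarrow> 'a::zero poly set" where
  "polys_below n = {p. \<forall>i\<ge>n. coeff p i = 0}"

lemma polys_below_zero [simp]: "p \<in> polys_below 0 \<longleftrightarrow> p = 0"
  by (auto simp: polys_below_def poly_eq_iff)

lemma polys_below_add:
  fixes p q :: "'a::comm_ring_1 poly"
  shows "p \<in> polys_below n \<Longrightarrow> q \<in> polys_below n \<Longrightarrow> p + q \<in> polys_below n"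
  by (auto simp: polys_below_def)

lemma polys_below_diff:
  fixes p q :: "'a::comm_ring_1 poly"
  shows "p \<in> polys_below n \<Longrightarrow> q \<in> polys_below n \<Longrightarrow> p - q \<in> polys_below n"
  by (auto simp: polys_below_def)

lemma polys_below_smult:
  fixes p :: "'a::comm_ring_1 poly"
  shows "p \<in> polys_below n \<Longrightarrow> smult c p \<in> polys_below n"
  by (auto simp: polys_below_def)

lemma polys_below_mono: "p \<in> polys_below m \<Longrightarrow> m \<le> n \<Longrightarrow> p \<in> polys_below n"
  by (auto simp: polys_below_def)

lemma degree_less_imp_polys_below: "degree p < n \<Longrightarrow> p \<in> polys_below n"
  by (auto simp: polys_below_def coeff_eq_0)

definition monic_of_degree :: "nat \<Rightarrow> 'a::comm_ring_1 poly \<Rightarrow> bool" where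
  "monic_of_degree n p \<longleftrightarrow> degree p = n \<and> lead_coeff p = 1"

lemma monic_of_degree_polys_below: "monic_of_degree n p \<Longrightarrow> p \<in> polys_below (Suc n)"
  by (auto simp: monic_of_degree_def intro: degree_less_imp_polys_below)

lemma monic_of_degree_diff_polys_below:
  "monic_of_degree n p \<Longrightarrow> q \<in> polys_below n \<Longrightarrow> monic_of_degree n (p - q)"
proof -
  assume p: "monic_of_degree n p" and q: "q \<in> polys_below n"
  have 1: "coeff (p - q) n = 1"
    using p q by (auto simp: monic_of_degree_def polys_below_def)
  have 2: "coeff (p - q) i = 0" if "i > n" for i
    using p q that by (auto simp: monic_of_degree_def polys_below_def coeff_eq_0)
  have "degree (p - q) = n"
    using 1 2 by (metis degree_le le_antisym le_degree zero_neq_one)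
  with 1 show ?thesis by (simp add: monic_of_degree_def)
qed

lemma monic_of_degree_diff:
  "monic_of_degree n p \<Longrightarrow> monic_of_degree n q \<Longrightarrow> p - q \<in> polys_below n"
  by (auto simp: monic_of_degree_def polys_below_def coeff_eq_0 le_less)

lemma monic_of_degree_monom: "monic_of_degree n (monom 1 n :: 'a::comm_ring_1 poly)"
  by (simp add: monic_of_degree_def degree_monom_eq)

lemma polys_below_Suc_reduce:
  assumes "monic_of_degree n a" "p \<in> polys_below (Suc n)"
  shows "p - smult (coeff p n) a \<in> polys_below n"
proof -
  have "coeff (p - smult (coeff p n) a) i = 0" if "i \<ge> n" for i
  proof (cases "i = n")
    case True
    then show ?thesis using assms(1) by (auto simp: monic_of_degree_def)
  next
    case False
    with that assms show ?thesis
      by (auto simp: monic_of_degree_def polys_below_def coeff_eq_0)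
  qed
  then show ?thesis unfolding polys_below_def by blast
qed

text \<open>Isolates what Gram-Schmidt uses. Linearity on the left follows from
  \<open>B_swap\<close>; \<open>not_perp\<close> and \<open>pos_witness\<close> carry all the
  nondegeneracy and are where the weight enters.\<close>

locale skew_moment =
  fixes B :: "real poly \<Rightarrow> real poly \<Rightarrow> real" and L :: "real poly \<Rightarrow> real"
  assumes B_add_right: "B p (q + r) = B p q + B p r"
    and B_smult_right: "B p (smult c q) = c * B p q"
    and B_swap: "B q p = - B p q"
    and L_add: "L (p + q) = L p + L q"
    and L_smult: "L (smult c p) = c * L p"
    and not_perp: "\<lbrakk>lead_coeff p = 1; L p \<le> 0\<rbrakk> \<Longrightarrow> \<exists>q. degree q \<le> degree p \<and> B p q \<noteq> 0"
    and pos_witness: "\<lbrakk>lead_coeff p = 1; L p > 0\<rbrakk> \<Longrightarrow>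
      \<exists>q. degree q \<le> Suc (degree p) \<and> lead_coeff q = 1 \<and> B p q > 0"
begin

lemma B_diff_right: "B p (q - r) = B p q - B p r"
  using B_add_right[of p q "smult (-1) r"] B_smult_right[of p "-1" r] by simp

lemma B_diff_left: "B (p - q) r = B p r - B q r"
  using B_diff_right[of r p q] by (simp add: B_swap[of r])

lemma B_smult_left: "B (smult c p) q = c * B p q"
  using B_smult_right[of q c p] by (simp add: B_swap[of q])

lemma B_self [simp]: "B p p = 0"
  using B_swap[of p p] by simp

lemma B_zero_right [simp]: "B p 0 = 0"
  using B_smult_right[of p 0 0] by simp

lemma L_diff: "L (p - q) = L p - L q"
  using L_add[of p "smult (-1) q"] L_smult[of "-1" q] by simp

definition perp :: "real poly \<Rightarrow> nat \<Rightarrow> bool" where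
  "perp p n \<longleftrightarrow> (\<forall>q \<in> polys_below n. B p q = 0)"

lemma perpD: "perp p n \<Longrightarrow> q \<in> polys_below n \<Longrightarrow> B p q = 0"
  by (simp add: perp_def)

lemma perp_diff: "perp p n \<Longrightarrow> perp q n \<Longrightarrow> perp (p - q) n"
  by (simp add: perp_def B_diff_left)

lemma perp_smult: "perp p n \<Longrightarrow> perp (smult c p) n"
  by (simp add: perp_def B_smult_left)

text \<open>One new monic polynomial accounts for the one new degree. With \<open>p = a\<close> the
  last hypothesis is automatic by antisymmetry.\<close>

lemma perp_Suc:
  assumes a: "monic_of_degree n a" and "perp p n" "B p a = 0"
  shows "perp p (Suc n)"
  unfolding perp_def
proof
  fix q :: "real poly" assume "q \<in> polys_below (Suc n)"
  then have "B p (q - smult (coeff q n) a) = 0"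
    using a assms(2) polys_below_Suc_reduce perpD by blast
  then show "B p q = 0"
    using assms(3) by (simp add: B_diff_right B_smult_right)
qed

text \<open>The block of members \<open>2 * k\<close> and \<open>2 * k + 1\<close>. The other
  conditions survive adding a multiple of \<open>a\<close> to \<open>b\<close>;
  \<open>L b = 0\<close> fixes that multiple.\<close>

definition skew_pair :: "nat \<Rightarrow> real poly \<Rightarrow> real poly \<Rightarrow> bool" where
  "skew_pair k a b \<longleftrightarrow> monic_of_degree (2 * k) a \<and> monic_of_degree (2 * k + 1) b \<and>
     perp a (2 * k) \<and> perp b (2 * k) \<and> L a > 0 \<and> L b = 0 \<and> B a b > 0"

text \<open>Projection is a hypothesis because pairs and projections are built alternately:
  projection below degree \<open>2 * k\<close> gives the pair \<open>k\<close>, which extends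
  projection by two degrees.\<close>

lemma skew_pair_exists_if_proj:
  assumes proj: "\<And>p. \<exists>q \<in> polys_below (2 * k). perp (p - q) (2 * k)"
  shows "\<exists>a b. skew_pair k a b"
proof -
  obtain q where q: "q \<in> polys_below (2 * k)" "perp (monom 1 (2 * k) - q) (2 * k)"
    using proj by blast
  define a where "a = monom 1 (2 * k) - q"
  have a: "monic_of_degree (2 * k) a" "perp a (2 * k)"
    using q monic_of_degree_diff_polys_below monic_of_degree_monom unfolding a_def by blast+
  \<comment> \<open>\<open>B a a = 0\<close> extends orthogonality by one degree; this is why blocks
    start at even degrees.\<close>
  then have a': "perp a (Suc (2 * k))"
    using perp_Suc by simp
  have La: "L a > 0"
  proof (rule ccontr)
    assume "\<not> L a > 0"
    then obtain r where "degree r \<le> 2 * k" "B a r \<noteq> 0"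
      using not_perp[of a] a(1) by (auto simp: monic_of_degree_def)
    with perpD[OF a'] degree_less_imp_polys_below[of r "Suc (2 * k)"] show False by simp
  qed
  obtain c where c: "degree c \<le> Suc (2 * k)" "lead_coeff c = 1" "B a c > 0"
    using pos_witness[of a] a(1) La by (auto simp: monic_of_degree_def)
  \<comment> \<open>By \<open>a'\<close> a witness of degree at most \<open>2 * k\<close> would pair
    to zero, so the degree is exactly \<open>2 * k + 1\<close>.\<close>
  have "degree c \<noteq> 2 * k" "\<not> degree c < 2 * k"
    using perpD[OF a', of c] c(3) degree_less_imp_polys_below[of c "Suc (2 * k)"] by auto
  with c have c': "monic_of_degree (2 * k + 1) c"
    by (auto simp: monic_of_degree_def)
  obtain q' where q': "q' \<in> polys_below (2 * k)" "perp (c - q') (2 * k)"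
    using proj by blast
  \<comment> \<open>The last term cancels \<open>L\<close>. Neither correction changes the pairing
    with \<open>a\<close>, so \<open>B a b = B a c > 0\<close>.\<close>
  define b where "b = c - q' - smult (L (c - q') / L a) a"
  have "q' \<in> polys_below (2 * k + 1)" "a \<in> polys_below (2 * k + 1)"
    using q' polys_below_mono a(1) monic_of_degree_polys_below by fastforce+
  then have b: "monic_of_degree (2 * k + 1) b"
    unfolding b_def using c' by (intro monic_of_degree_diff_polys_below polys_below_smult)
  have "perp b (2 * k)"
    unfolding b_def using q' a by (intro perp_diff[of "c - q'"] perp_smult)
  moreover have "L b = 0"
    using La by (simp add: b_def L_diff[of "c - q'"] L_smult)
  moreover have "B a b > 0"
    using c(3) perpD[OF a(2) q'(1)] by (simp add: b_def B_diff_right B_smult_right)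
  ultimately have "skew_pair k a b"
    unfolding skew_pair_def using a b La by blast
  then show ?thesis by blast
qed

lemma proj_exists: "\<exists>q \<in> polys_below (2 * k). perp (p - q) (2 * k)"
proof (induction k arbitrary: p)
  case 0
  then show ?case by (auto simp: perp_def)
next
  case (Suc k)
  obtain a b where ab: "skew_pair k a b"
    using skew_pair_exists_if_proj Suc.IH by blast
  then have a: "monic_of_degree (2 * k) a" "perp a (2 * k)"
    and b: "monic_of_degree (2 * k + 1) b" "perp b (2 * k)" and s: "B a b > 0"
    by (auto simp: skew_pair_def)
  obtain q where q: "q \<in> polys_below (2 * k)" "perp (p - q) (2 * k)"
    using Suc.IH by blast
  \<comment> \<open>Solves the antisymmetric 2 by 2 system in the span of \<open>a\<close> and
    \<open>b\<close>: \<open>q'\<close> has the same pairings with \<open>a\<close> and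
    \<open>b\<close> as \<open>p - q\<close>.\<close>
  define q' where "q' = smult (B (p - q) b / B a b) a - smult (B (p - q) a / B a b) b"
  have *: "perp (p - q - q') (2 * k)"
    unfolding q'_def using a b q by (intro perp_diff[of "p - q"] perp_smult perp_diff[of "smult _ _"])
  have "B b a = - B a b" by (rule B_swap)
  then have B_q': "B q' a = B (p - q) a" "B q' b = B (p - q) b"
    unfolding q'_def B_diff_left[of "smult _ _"] B_smult_left using s by simp_all
  have "B (p - q - q') a = 0" "B (p - q - q') b = 0"
    unfolding B_diff_left[of "p - q"] B_q' by simp_all
  then have "perp (p - q - q') (Suc (Suc (2 * k)))"
    using perp_Suc[OF a(1) *] perp_Suc[OF b(1), of "p - q - q'"] by simp
  then have "perp (p - (q + q')) (2 * Suc k)"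
    by (simp add: algebra_simps)
  moreover have "q + q' \<in> polys_below (2 * Suc k)"
    unfolding q'_def
    using polys_below_mono[OF q(1), of "2 * Suc k"]
      polys_below_mono[OF monic_of_degree_polys_below[OF a(1)], of "2 * Suc k"]
      polys_below_mono[OF monic_of_degree_polys_below[OF b(1)], of "2 * Suc k"]
    by (intro polys_below_add polys_below_diff polys_below_smult) auto
  ultimately show ?case by blast
qed

lemma skew_pair_exists: "\<exists>a b. skew_pair k a b"
  by (rule skew_pair_exists_if_proj) (rule proj_exists)

text \<open>Nondegeneracy on even-dimensional spaces. Write \<open>p\<close> as a combination of the
  top pair plus a remainder orthogonal to that pair; pairing with \<open>a\<close> and
  \<open>b\<close> kills both coefficients, and induction kills the remainder.\<close>

lemma perp_polys_below_eq_0: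
  "p \<in> polys_below (2 * k) \<Longrightarrow> perp p (2 * k) \<Longrightarrow> p = 0"
proof (induction k arbitrary: p)
  case 0
  then show ?case by simp
next
  case (Suc k)
  obtain a b where ab: "skew_pair k a b"
    using skew_pair_exists by blast
  then have a: "monic_of_degree (2 * k) a" "perp a (2 * k)"
    and b: "monic_of_degree (2 * k + 1) b" "perp b (2 * k)" and s: "B a b > 0"
    by (auto simp: skew_pair_def)
  define \<beta> where "\<beta> = coeff p (2 * k + 1)"
  define p1 where "p1 = p - smult \<beta> b"
  define \<alpha> where "\<alpha> = coeff p1 (2 * k)"
  define p2 where "p2 = p1 - smult \<alpha> a"
  have p1: "p1 \<in> polys_below (2 * k + 1)"
    unfolding p1_def \<beta>_def using polys_below_Suc_reduce[OF b(1)] Suc.prems(1) by simp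
  then have p2: "p2 \<in> polys_below (2 * k)"
    unfolding p2_def \<alpha>_def using polys_below_Suc_reduce[OF a(1)] by simp
  have ab_in: "a \<in> polys_below (2 * Suc k)" "b \<in> polys_below (2 * Suc k)"
    using polys_below_mono[OF monic_of_degree_polys_below[OF a(1)], of "2 * Suc k"]
      polys_below_mono[OF monic_of_degree_polys_below[OF b(1)], of "2 * Suc k"] by auto
  have "B p2 a = 0" "B p2 b = 0"
    using perpD[OF a(2) p2] perpD[OF b(2) p2] B_swap[of a p2] B_swap[of b p2] by simp_all
  moreover have "B p a = 0" "B p b = 0"
    using perpD[OF Suc.prems(2)] ab_in by blast+
  ultimately have "\<alpha> * B a b = 0" "\<beta> * B a b = 0"
    by (simp_all add: p2_def p1_def B_diff_left B_smult_left B_swap[of a b])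
  then have "p = p2"
    using s by (simp add: p2_def p1_def)
  moreover have "perp p2 (2 * k)"
    using Suc.prems(2) \<open>p = p2\<close> polys_below_mono unfolding perp_def by fastforce
  ultimately show ?case using Suc.IH p2 by simp
qed

text \<open>Nondegeneracy first gives \<open>a = a'\<close>, then that \<open>b - b'\<close> is a
  multiple of \<open>a\<close>; applying \<open>L\<close> with \<open>L a > 0\<close> makes the
  multiple zero.\<close>

lemma skew_pair_unique:
  assumes "skew_pair k a b" "skew_pair k a' b'"
  shows "a = a'" "b = b'"
proof -
  note ab = assms[unfolded skew_pair_def]
  have "a - a' = 0"
    using ab by (intro perp_polys_below_eq_0[of _ k] monic_of_degree_diff perp_diff) auto
  then show "a = a'" by simp
  define c where "c = coeff (b - b') (2 * k)"
  have "b - b' \<in> polys_below (Suc (2 * k))"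
    using ab by (intro monic_of_degree_diff) auto
  then have "b - b' - smult c a = 0"
    using ab unfolding c_def
    by (intro perp_polys_below_eq_0[of _ k] polys_below_Suc_reduce perp_diff perp_smult) auto
  then have *: "b - b' = smult c a" by simp
  have "c * L a = L b - L b'"
    using L_smult[of c a] L_diff[of b b'] * by simp
  then have "c = 0" using ab by simp
  with * show "b = b'" by simp
qed

section \<open>From skew pairs to skew-orthogonal families\<close>

lemma monic_family_perp:
  fixes \<phi> :: "nat \<Rightarrow> real poly"
  assumes "\<And>i. monic_of_degree i (\<phi> i)" "\<And>i. i < n \<Longrightarrow> B p (\<phi> i) = 0"
  shows "perp p n"
  using assms(2)
proof (induction n)
  case 0
  then show ?case by (simp add: perp_def)
next
  case (Suc n)
  then show ?case using perp_Suc[OF assms(1)] by simp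
qed

text \<open>The conditions decouple into blocks with equal index \<open>div 2\<close>: across blocks
  they amount to \<open>perp\<close> together with antisymmetry.\<close>

lemma skew_orthogonal_family_iff:
  "(\<forall>i. degree (\<phi> i) = i \<and> lead_coeff (\<phi> i) = 1) \<and>
    (\<exists>(\<sigma> :: nat \<Rightarrow> real) (\<gamma> :: nat \<Rightarrow> real).
       (\<forall>k. \<sigma> k > 0) \<and>
       (\<forall>i. even i \<longrightarrow> \<gamma> i > 0) \<and>
       (\<forall>k. B (\<phi> (2 * k)) (\<phi> (2 * k + 1)) = \<sigma> k) \<and>
       (\<forall>k. B (\<phi> (2 * k + 1)) (\<phi> (2 * k)) = - \<sigma> k) \<and>
       (\<forall>i j. (\<nexists>k. (i, j) = (2 * k, 2 * k + 1) \<or> (i, j) = (2 * k + 1, 2 * k)) \<longrightarrow>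
          B (\<phi> i) (\<phi> j) = 0) \<and>
       (\<forall>i. L (\<phi> i) = (if even i then \<gamma> i else 0))) \<longleftrightarrow>
   (\<forall>k. skew_pair k (\<phi> (2 * k)) (\<phi> (2 * k + 1)))" (is "?monic \<and> ?ex \<longleftrightarrow> ?pairs")
proof
  assume *: "?monic \<and> ?ex"
  from conjunct1[OF *] have monic: "monic_of_degree i (\<phi> i)" for i
    unfolding monic_of_degree_def by blast
  from conjunct2[OF *] obtain \<sigma> \<gamma> :: "nat \<Rightarrow> real" where pos: "\<forall>k. \<sigma> k > 0" "\<forall>i. even i \<longrightarrow> \<gamma> i > 0"
    and B\<sigma>: "\<forall>k. B (\<phi> (2 * k)) (\<phi> (2 * k + 1)) = \<sigma> k"
    and orth: "\<forall>i j. (\<nexists>k. (i, j) = (2 * k, 2 * k + 1) \<or> (i, j) = (2 * k + 1, 2 * k)) \<longrightarrow>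
          B (\<phi> i) (\<phi> j) = 0"
    and L\<gamma>: "\<forall>i. L (\<phi> i) = (if even i then \<gamma> i else 0)"
    by (elim exE conjE)
  have B: "B (\<phi> (2 * k)) (\<phi> (2 * k + 1)) > 0" and L: "L (\<phi> (2 * k)) > 0" "L (\<phi> (2 * k + 1)) = 0" for k
    using pos B\<sigma> L\<gamma> by simp_all
  show ?pairs
  proof
    fix k
    have "perp (\<phi> (2 * k)) (2 * k)" "perp (\<phi> (2 * k + 1)) (2 * k)"
      \<comment> \<open>An index below \<open>2 * k\<close> never forms an exceptional pair with
        \<open>2 * k\<close> or \<open>2 * k + 1\<close>.\<close>
      by (rule monic_family_perp[OF monic], rule orth[rule_format], simp only: prod.inject, presburger)+
    with B L monic show "skew_pair k (\<phi> (2 * k)) (\<phi> (2 * k + 1))"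
      unfolding skew_pair_def by blast
  qed
next
  assume pairs: ?pairs
  have monic: "monic_of_degree i (\<phi> i)" for i
  proof (cases "even i")
    case True
    then obtain k where "i = 2 * k" by blast
    then show ?thesis using pairs by (simp add: skew_pair_def)
  next
    case False
    then obtain k where "i = 2 * k + 1" by (rule oddE)
    then show ?thesis using pairs by (simp add: skew_pair_def)
  qed
  have orth_less: "B (\<phi> i) (\<phi> j) = 0" if "j div 2 < i div 2" for i j
  proof -
    define k where "k = i div 2"
    have "i = 2 * k \<or> i = 2 * k + 1" unfolding k_def by auto
    then have "perp (\<phi> i) (2 * k)" using pairs by (auto simp: skew_pair_def)
    moreover have "\<phi> j \<in> polys_below (2 * k)"
      using polys_below_mono[OF monic_of_degree_polys_below[OF monic], of j "2 * k"] that
      by (simp add: k_def)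
    ultimately show ?thesis by (rule perpD)
  qed
  have orth: "B (\<phi> i) (\<phi> j) = 0"
    if "\<nexists>k. (i, j) = (2 * k, 2 * k + 1) \<or> (i, j) = (2 * k + 1, 2 * k)" for i j
  proof -
    consider "j div 2 < i div 2" | "i div 2 < j div 2" | "i div 2 = j div 2" by linarith
    then show ?thesis
    proof cases
      case 1
      then show ?thesis by (rule orth_less)
    next
      case 2
      then show ?thesis using orth_less B_swap[of "\<phi> j" "\<phi> i"] by simp
    next
      case 3
      have "i = j"
      proof (rule ccontr)
        assume "i \<noteq> j"
        with 3 have "(i, j) = (2 * (i div 2), 2 * (i div 2) + 1) \<or>
            (i, j) = (2 * (i div 2) + 1, 2 * (i div 2))"
          by auto
        with that show False by blast
      qed
      then show ?thesis by simp
    qed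
  qed
  have L: "L (\<phi> (2 * k)) > 0" "L (\<phi> (2 * k + 1)) = 0" "B (\<phi> (2 * k)) (\<phi> (2 * k + 1)) > 0" for k
    using pairs by (auto simp: skew_pair_def)
  have L_even: "L (\<phi> i) > 0" if "even i" for i
    using that L(1) by (metis evenE)
  have L_odd: "L (\<phi> i) = 0" if "odd i" for i
    using that L(2) by (metis oddE)
  have ex: ?ex
  \<comment> \<open>The constants are forced: they are the values of \<open>B\<close> and
    \<open>L\<close> themselves.\<close>
  proof (rule exI[of _ "\<lambda>k. B (\<phi> (2 * k)) (\<phi> (2 * k + 1))"], rule exI[of _ "\<lambda>i. L (\<phi> i)"],
      intro conjI allI impI)
    fix i j :: nat
    assume "\<nexists>k. (i, j) = (2 * k, 2 * k + 1) \<or> (i, j) = (2 * k + 1, 2 * k)"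
    then show "B (\<phi> i) (\<phi> j) = 0" by (rule orth)
  qed (simp_all add: L L_even L_odd B_swap[symmetric] del: One_nat_def)
  show "?monic \<and> ?ex"
    using monic unfolding monic_of_degree_def by (intro conjI ex) blast
qed

theorem skew_orthogonal_family_ex1:
  "\<exists>!\<phi> :: nat \<Rightarrow> real poly. \<forall>k. skew_pair k (\<phi> (2 * k)) (\<phi> (2 * k + 1))"
proof -
  obtain a b where ab: "\<And>k. skew_pair k (a k) (b k)"
    using skew_pair_exists by metis
  show ?thesis
  proof (rule ex1I[of _ "\<lambda>i. if even i then a (i div 2) else b (i div 2)"])
    show "\<forall>k. skew_pair k (if even (2 * k) then a (2 * k div 2) else b (2 * k div 2))
      (if even (2 * k + 1) then a ((2 * k + 1) div 2) else b ((2 * k + 1) div 2))"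
      using ab by simp
  next
    fix \<phi> :: "nat \<Rightarrow> real poly"
    assume \<phi>: "\<forall>k. skew_pair k (\<phi> (2 * k)) (\<phi> (2 * k + 1))"
    show "\<phi> = (\<lambda>i. if even i then a (i div 2) else b (i div 2))"
    proof
      fix i
      have "\<phi> (2 * k) = a k" "\<phi> (2 * k + 1) = b k" for k
        using skew_pair_unique \<phi> ab by blast+
      from this[of "i div 2"] show "\<phi> i = (if even i then a (i div 2) else b (i div 2))"
        by (auto simp: odd_two_times_div_two_succ elim!: oddE)
    qed
  qed
qed

end

section \<open>Sign changes of a function driven by a polynomial\<close>

text \<open>Opposite strict signs at two points of \<open>S\<close> would force a root strictly
  between them. Roots at end points of \<open>S\<close> stay allowed, so closed intervals between
  roots qualify.\<close>

lemma poly_sign_constant: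
  fixes p :: "real poly"
  assumes "\<And>x y t. x \<in> S \<Longrightarrow> y \<in> S \<Longrightarrow> x < t \<Longrightarrow> t < y \<Longrightarrow> poly p t \<noteq> 0"
  shows "(\<forall>x\<in>S. poly p x \<ge> 0) \<or> (\<forall>x\<in>S. poly p x \<le> 0)"
proof (rule ccontr)
  assume "\<not> ?thesis"
  then obtain x y where xy: "x \<in> S" "y \<in> S" "poly p x < 0" "poly p y > 0"
    by force
  then consider "x < y" | "y < x" by (metis less_asym linorder_neqE)
  then show False
    using poly_IVT_pos[of x y p] poly_IVT_neg[of y x p] assms xy by cases blast+
qed

text \<open>
  Invariant of a sweep from left to right: the roots of \<open>q\<close> are the sign changes of \<open>G\<close> up to \<open>b\<close>,
  and \<open>\<epsilon>\<close> is the current sign of \<open>G\<close>.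
\<close>

definition sign_fit :: "(real \<Rightarrow> real) \<Rightarrow> real \<Rightarrow> nat \<Rightarrow> real \<Rightarrow> real poly \<Rightarrow> bool" where
  "sign_fit G b n \<epsilon> q \<longleftrightarrow> (\<epsilon> = 1 \<or> \<epsilon> = -1) \<and> lead_coeff q = 1 \<and> degree q \<le> n \<and>
     (\<forall>x>b. poly q x > 0) \<and> (\<forall>x\<le>b. \<epsilon> * poly q x * G x \<ge> 0) \<and> \<epsilon> * G b \<ge> 0"

text \<open>A monotone function changes sign at most once, so one linear factor is enough.\<close>

lemma sign_fit_start:
  assumes "mono_on {..b} G \<or> antimono_on {..b} G"
  shows "\<exists>\<epsilon> q. sign_fit G b 1 \<epsilon> q"
proof -
  define \<epsilon> :: real where "\<epsilon> = (if G b \<ge> 0 then 1 else -1)"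
  define H where "H x = \<epsilon> * G x" for x
  have eps: "\<epsilon> = 1 \<or> \<epsilon> = -1" and Hb: "H b \<ge> 0"
    by (auto simp: \<epsilon>_def H_def)
  have H: "mono_on {..b} H \<or> antimono_on {..b} H"
    using assms eps unfolding H_def monotone_on_def by auto
  show ?thesis
  proof (cases "\<forall>x\<le>b. H x \<ge> 0")
    case True
    then have "sign_fit G b 1 \<epsilon> 1"
      using eps Hb by (auto simp: sign_fit_def H_def)
    then show ?thesis by blast
  next
    case False
    then obtain y where y: "y \<le> b" "H y < 0" by force
    \<comment> \<open>A decreasing \<open>H\<close> with \<open>H b \<ge> 0\<close> could not be
      negative at \<open>y\<close>.\<close>
    then have mono: "H u \<le> H v" if "u \<le> v" "v \<le> b" for u v
      using H Hb that unfolding monotone_on_def by (smt (verit) atMost_iff)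
    define S where "S = {x. x \<le> b \<and> H x < 0}"
    \<comment> \<open>The crossing point. The value of \<open>H\<close> at \<open>s\<close> is
      harmless because the factor \<open>x - s\<close> vanishes there.\<close>
    define s where "s = Sup S"
    have S: "S \<noteq> {}" "bdd_above S"
      using y by (auto simp: S_def bdd_above_def)
    have "s \<le> b"
      unfolding s_def using S by (intro cSup_least) (auto simp: S_def)
    have less: "H x \<le> 0" if "x < s" for x
    proof -
      obtain u where "u \<in> S" "x < u"
        using less_cSupD[OF S(1)] \<open>x < s\<close> s_def by blast
      then show ?thesis using mono[of x u] by (auto simp: S_def)
    qed
    have greater: "H x \<ge> 0" if "x > s" "x \<le> b" for x
      using cSup_upper[OF _ S(2), of x] that by (force simp: S_def s_def)
    have "(x - s) * H x \<ge> 0" if "x \<le> b" for x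
      using less[of x] greater[of x] that
      by (cases x s rule: linorder_cases) (auto simp: zero_le_mult_iff)
    then have "sign_fit G b 1 \<epsilon> [:- s, 1:]"
      using eps Hb \<open>s \<le> b\<close> by (auto simp: sign_fit_def H_def algebra_simps)
    then show ?thesis by blast
  qed
qed

text \<open>A crossing in the new interval adds a linear factor and flips \<epsilon>; without one,
  \<open>q\<close> is kept, since \<open>n\<close> only bounds the degree.\<close>

lemma sign_fit_step:
  assumes fit: "sign_fit G a n \<epsilon> q" and "a < b"
    and "mono_on {a..b} G \<or> antimono_on {a..b} G"
  shows "\<exists>\<epsilon> q. sign_fit G b (Suc n) \<epsilon> q"
proof -
  define H where "H x = \<epsilon> * G x" for x
  have eps: "\<epsilon> = 1 \<or> \<epsilon> = -1" and Ha: "H a \<ge> 0" and q: "lead_coeff q = 1" "degree q \<le> n"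
    "\<And>x. x > a \<Longrightarrow> poly q x > 0" "\<And>x. x \<le> a \<Longrightarrow> poly q x * H x \<ge> 0"
    using fit by (auto simp: sign_fit_def H_def mult_ac)
  have H: "mono_on {a..b} H \<or> antimono_on {a..b} H"
    using assms eps unfolding H_def monotone_on_def by auto
  show ?thesis
  proof (cases "\<forall>x\<in>{a..b}. H x \<ge> 0")
    case True
    have "poly q x * H x \<ge> 0" if "x \<le> b" for x
      using True q(3,4)[of x] that by (cases "x \<le> a") auto
    then have "sign_fit G b (Suc n) \<epsilon> q"
      using True eps q \<open>a < b\<close> by (auto simp: sign_fit_def H_def mult_ac)
    then show ?thesis by blast
  next
    case False
    then obtain y where y: "a \<le> y" "y \<le> b" "H y < 0" by force
    \<comment> \<open>\<open>H a \<ge> 0\<close> together with a later negative value leaves only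
      the decreasing case.\<close>
    then have anti: "H v \<le> H u" if "a \<le> u" "u \<le> v" "v \<le> b" for u v
      using H Ha that unfolding monotone_on_def by (smt (verit) atLeastAtMost_iff)
    define S where "S = {x. a \<le> x \<and> x \<le> b \<and> H x \<ge> 0}"
    define s where "s = Sup S"
    have S: "a \<in> S" "bdd_above S"
      using Ha \<open>a < b\<close> by (auto simp: S_def bdd_above_def)
    have "s \<le> b"
      unfolding s_def using S by (intro cSup_least) (auto simp: S_def)
    have "a \<le> s"
      unfolding s_def using S by (intro cSup_upper)
    have less: "H x \<ge> 0" if "a \<le> x" "x < s" for x
    proof -
      obtain u where "u \<in> S" "x < u"
        using less_cSupD[of S x] S \<open>x < s\<close> s_def by blast
      then show ?thesis using anti[of x u] that by (auto simp: S_def)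
    qed
    have greater: "H x \<le> 0" if "x > s" "x \<le> b" for x
      using cSup_upper[OF _ S(2), of x] that \<open>a \<le> s\<close> by (force simp: S_def s_def)
    have main: "(s - x) * (poly q x * H x) \<ge> 0" if "x \<le> b" for x
    proof (cases "x \<le> a")
      case True
      then show ?thesis using mult_nonneg_nonneg[of "s - x", OF _ q(4)[OF True]] \<open>a \<le> s\<close> by simp
    next
      case False
      have "(s - x) * H x \<ge> 0"
        using less[of x] greater[of x] that False
        by (cases x s rule: linorder_cases) (auto simp: zero_le_mult_iff)
      then have "poly q x * ((s - x) * H x) \<ge> 0"
        using mult_nonneg_nonneg[of "poly q x" "(s - x) * H x"] q(3)[of x] False by linarith
      then show ?thesis by (simp add: mult_ac)
    qed
    have "q \<noteq> 0" using q(1) by auto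
    then have "degree (q * [:- s, 1:]) \<le> Suc n"
      using q(2) by (subst degree_mult_eq) auto
    moreover have "lead_coeff (q * [:- s, 1:]) = 1"
      using q(1) by (simp only: lead_coeff_mult) simp
    moreover have "poly (q * [:- s, 1:]) x > 0" if "x > b" for x
      using q(3)[of x] that \<open>s \<le> b\<close> \<open>a < b\<close> by simp
    moreover have "- \<epsilon> * poly (q * [:- s, 1:]) x * G x \<ge> 0" if "x \<le> b" for x
      using main[OF that] by (simp add: H_def algebra_simps)
    moreover have "- \<epsilon> * G b \<ge> 0"
      using anti[of y b] y by (simp add: H_def)
    ultimately have "sign_fit G b (Suc n) (- \<epsilon>) (q * [:- s, 1:])"
      using eps unfolding sign_fit_def by auto
    then show ?thesis by blast
  qed
qed

text \<open>No new factor arises: if \<epsilon> is 1, then \<open>G a \<ge> 0\<close> and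
  monotonicity force \<open>G\<close> to vanish from \<open>a\<close> on; if it is -1, the sign
  already fits.\<close>

lemma sign_fit_finish_nonpos:
  assumes fit: "sign_fit G a n \<epsilon> q" and mono: "mono_on {a..} G" and nonpos: "\<And>x. x \<ge> a \<Longrightarrow> G x \<le> 0"
  shows "\<epsilon> * poly q x * G x \<ge> 0"
proof (cases "x \<le> a")
  case True
  then show ?thesis using fit by (simp add: sign_fit_def)
next
  case False
  then have x: "poly q x > 0" "G x \<ge> G a" "G x \<le> 0"
    using fit mono nonpos by (auto simp: sign_fit_def monotone_on_def)
  have "\<epsilon> * G x \<ge> 0"
    using fit x by (auto simp: sign_fit_def)
  then have "poly q x * (\<epsilon> * G x) \<ge> 0"
    using mult_nonneg_nonneg[of "poly q x" "\<epsilon> * G x"] x by linarith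
  then show ?thesis by (simp add: mult_ac)
qed

text \<open>The final sign is positive, so \<epsilon> disappears: an increasing \<open>G\<close>
  crosses zero at most once more, and only if \<epsilon> is -1.\<close>

lemma sign_fit_finish_pos:
  assumes fit: "sign_fit G a n \<epsilon> q" and "mono_on {a..} G" and "y \<ge> a" "G y > 0"
  shows "\<exists>q. lead_coeff q = 1 \<and> degree q \<le> Suc n \<and> (\<forall>x. poly q x * G x \<ge> 0)"
proof -
  have mono: "G u \<le> G v" if "a \<le> u" "u \<le> v" for u v
    using assms(2) that by (auto simp: monotone_on_def)
  have q: "lead_coeff q = 1" "degree q \<le> n" "\<And>x. x > a \<Longrightarrow> poly q x > 0"
    "\<And>x. x \<le> a \<Longrightarrow> \<epsilon> * poly q x * G x \<ge> 0"
    using fit by (auto simp: sign_fit_def)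
  consider "\<epsilon> = 1" "G a \<ge> 0" | "\<epsilon> = -1" "G a \<le> 0" using fit by (auto simp: sign_fit_def)
  then show ?thesis
  proof cases
    case 1
    have "poly q x * G x \<ge> 0" for x
      using q(3,4)[of x] mono[of a x] 1 by (cases "x \<le> a") auto
    then show ?thesis using q by (intro exI[of _ q]) auto
  next
    case 2
    define S where "S = {x. a \<le> x \<and> G x \<le> 0}"
    define s where "s = Sup S"
    have "x \<le> y" if "x \<in> S" for x
      using mono[of y x] that assms(3,4) by (force simp: S_def)
    then have S: "a \<in> S" "bdd_above S"
      using 2 by (auto simp: S_def bdd_above_def)
    have "a \<le> s"
      unfolding s_def using S by (intro cSup_upper)
    have less: "G x \<le> 0" if "a \<le> x" "x < s" for x
    proof -
      obtain u where "u \<in> S" "x < u"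
        using less_cSupD[of S x] S \<open>x < s\<close> s_def by blast
      then show ?thesis using mono[of x u] that by (auto simp: S_def)
    qed
    have greater: "G x \<ge> 0" if "x > s" for x
      using cSup_upper[OF _ S(2), of x] that \<open>a \<le> s\<close> by (force simp: S_def s_def)
    have "poly (q * [:- s, 1:]) x * G x \<ge> 0" for x
    proof (cases "x \<le> a")
      case True
      then have "(s - x) * (- poly q x * G x) \<ge> 0"
        using mult_nonneg_nonneg[of "s - x", OF _ q(4)[OF True]] \<open>a \<le> s\<close> 2(1) by simp
      then show ?thesis by (simp add: algebra_simps)
    next
      case False
      have "(x - s) * G x \<ge> 0"
        using less[of x] greater[of x] False
        by (cases x s rule: linorder_cases) (auto simp: zero_le_mult_iff)
      then have "poly q x * ((x - s) * G x) \<ge> 0"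
        using mult_nonneg_nonneg[of "poly q x" "(x - s) * G x"] q(3)[of x] False by linarith
      then show ?thesis by (simp add: algebra_simps)
    qed
    moreover have "q \<noteq> 0" using q(1) by auto
    then have "degree (q * [:- s, 1:]) \<le> Suc n"
      using q(2) by (subst degree_mult_eq) auto
    moreover have "lead_coeff (q * [:- s, 1:]) = 1"
      using q(1) by (simp only: lead_coeff_mult) simp
    ultimately show ?thesis by blast
  qed
qed

text \<open>Monotonicity replaces the equation \<open>G' = 2 p w\<close>, since for a merely
  integrable weight \<open>G\<close> need not be differentiable everywhere.\<close>

locale sign_driven =
  fixes p :: "real poly" and G :: "real \<Rightarrow> real"
  assumes monic: "lead_coeff p = 1"
    and increase: "\<And>x y. x < y \<Longrightarrow> (\<And>t. x < t \<Longrightarrow> t < y \<Longrightarrow> poly p t \<ge> 0) \<Longrightarrow> G x \<le> G y"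
    and decrease: "\<And>x y. x < y \<Longrightarrow> (\<And>t. x < t \<Longrightarrow> t < y \<Longrightarrow> poly p t \<le> 0) \<Longrightarrow> G y \<le> G x"
begin

section \<open>Sweep over the roots of the driving polynomial\<close>

lemma p_nonzero [simp]: "p \<noteq> 0"
  using monic by auto

lemma mono_on_interval:
  assumes "is_interval S" "\<And>x. x \<in> S \<Longrightarrow> poly p x \<ge> 0"
  shows "mono_on S G"
proof (rule mono_onI)
  fix x y assume xy: "x \<in> S" "y \<in> S" "x \<le> y"
  then have "t \<in> S" if "x < t" "t < y" for t
    using assms(1) that unfolding is_interval_1 by (meson less_imp_le)
  then show "G x \<le> G y"
    using increase[of x y] xy assms(2) by (cases "x = y") auto
qed

lemma antimono_on_interval:
  assumes "is_interval S" "\<And>x. x \<in> S \<Longrightarrow> poly p x \<le> 0"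
  shows "antimono_on S G"
proof (rule monotone_onI)
  fix x y assume xy: "x \<in> S" "y \<in> S" "x \<le> y"
  then have "t \<in> S" if "x < t" "t < y" for t
    using assms(1) that unfolding is_interval_1 by (meson less_imp_le)
  then show "G x \<ge> G y"
    using decrease[of x y] xy assms(2) by (cases "x = y") auto
qed

lemma mono_or_antimono:
  assumes "is_interval S" "\<And>x y t. x \<in> S \<Longrightarrow> y \<in> S \<Longrightarrow> x < t \<Longrightarrow> t < y \<Longrightarrow> poly p t \<noteq> 0"
  shows "mono_on S G \<or> antimono_on S G"
proof -
  have "(\<forall>x\<in>S. poly p x \<ge> 0) \<or> (\<forall>x\<in>S. poly p x \<le> 0)"
    by (rule poly_sign_constant) (rule assms(2))
  then show ?thesis
  proof
    assume "\<forall>x\<in>S. poly p x \<ge> 0"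
    then show ?thesis using mono_on_interval[OF assms(1)] by simp
  next
    assume "\<forall>x\<in>S. poly p x \<le> 0"
    then show ?thesis using antimono_on_interval[OF assms(1)] by simp
  qed
qed

text \<open>A monic polynomial is eventually positive, so a negative value would force a later root.
  The point \<open>x\<close> may itself be a root.\<close>

lemma nonneg_beyond_roots:
  assumes "\<And>t. t > x \<Longrightarrow> poly p t \<noteq> 0"
  shows "poly p x \<ge> 0"
proof (rule ccontr)
  assume neg: "\<not> poly p x \<ge> 0"
  obtain n where n: "\<And>x. x \<ge> n \<Longrightarrow> poly p x \<ge> 1"
    using poly_pinfty_gt_lc[of p] monic by auto
  define y where "y = max n (x + 1)"
  have "x < y" "poly p y > 0"
    using n[of y] by (auto simp: y_def)
  then show False
    using poly_IVT_pos[of x y p] neg assms by auto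
qed

definition roots :: "real set" where "roots = {x. poly p x = 0}"

lemma finite_roots: "finite roots"
  unfolding roots_def by (rule poly_roots_finite) simp

text \<open>Each root closes one interval of monotonicity, the first one unbounded to the left;
  hence at most one sign change per root up to \<open>b\<close>.\<close>

lemma sign_fit_root:
  assumes "b \<in> roots"
  shows "\<exists>\<epsilon> q. sign_fit G b (card (roots \<inter> {..b})) \<epsilon> q"
  using assms
proof (induction "card (roots \<inter> {..b})" arbitrary: b rule: less_induct)
  case less
  show ?case
  proof (cases "roots \<inter> {..<b} = {}")
    case True
    then have "roots \<inter> {..b} = {b}" using less.prems by force
    moreover have "mono_on {..b} G \<or> antimono_on {..b} G"
      using True by (intro mono_or_antimono) (auto simp: is_interval_1 roots_def)
    ultimately show ?thesis using sign_fit_start by simp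
  next
    case False
    define a where "a = Max (roots \<inter> {..<b})"
    have fin: "finite (roots \<inter> {..<b})" using finite_roots by simp
    have a: "a \<in> roots" "a < b"
      using Max_in[OF fin False] unfolding a_def by auto
    have gap: "t \<notin> roots" if "a < t" "t < b" for t
      using Max_ge[OF fin, of t] that unfolding a_def by auto
    have "roots \<inter> {..b} = insert b (roots \<inter> {..a})"
      using a less.prems gap by (auto simp: not_less[symmetric] order_le_less)
    then have card: "card (roots \<inter> {..b}) = Suc (card (roots \<inter> {..a}))"
      using finite_roots a by simp
    then obtain \<epsilon> q where "sign_fit G a (card (roots \<inter> {..a})) \<epsilon> q"
      using less.hyps[of a] a by auto
    moreover have "mono_on {a..b} G \<or> antimono_on {a..b} G"
      using gap by (intro mono_or_antimono) (auto simp: is_interval_1 roots_def)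
    ultimately show ?thesis
      using sign_fit_step a card by metis
  qed
qed

lemma last_root:
  assumes "roots \<noteq> {}"
  obtains a \<epsilon> q where "sign_fit G a (degree p) \<epsilon> q" "mono_on {a..} G" "\<And>x. x \<ge> a \<Longrightarrow> poly p x \<ge> 0"
proof -
  define a where "a = Max roots"
  have a: "a \<in> roots" "\<And>t. t \<in> roots \<Longrightarrow> t \<le> a"
    using assms finite_roots by (auto simp: a_def)
  then have "roots \<inter> {..a} = roots" by auto
  then obtain \<epsilon> q where "sign_fit G a (card roots) \<epsilon> q"
    using sign_fit_root[OF a(1)] by auto
  moreover have "card roots \<le> degree p"
    unfolding roots_def by (rule card_poly_roots_bound) simp
  ultimately have "sign_fit G a (degree p) \<epsilon> q"
    by (auto simp: sign_fit_def)
  moreover have pos: "poly p x \<ge> 0" if "x \<ge> a" for x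
    using a that by (intro nonneg_beyond_roots) (force simp: roots_def)
  moreover have "mono_on {a..} G"
    by (rule mono_on_interval) (auto simp: is_interval_1 pos)
  ultimately show ?thesis using that by blast
qed

lemma no_roots:
  assumes "roots = {}"
  shows "poly p x \<ge> 0" "mono_on UNIV G"
proof -
  show pos: "poly p x \<ge> 0" for x
    using assms by (intro nonneg_beyond_roots) (auto simp: roots_def)
  show "mono_on UNIV G"
    by (rule mono_on_interval) (auto simp: pos)
qed

text \<open>The hypothesis reaches exactly the final stretch where \<open>p\<close> stays
  nonnegative; there \<open>G\<close> adds no sign change, which keeps the degree at most
  \<open>degree p\<close>.\<close>

lemma sign_polynomial_nonpos:
  assumes nonpos: "\<And>x. (\<And>t. t > x \<Longrightarrow> poly p t \<ge> 0) \<Longrightarrow> G x \<le> 0"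
  shows "\<exists>\<epsilon> q. lead_coeff q = 1 \<and> degree q \<le> degree p \<and> (\<forall>x. \<epsilon> * poly q x * G x \<ge> 0) \<and> \<epsilon> \<noteq> 0"
proof (cases "roots = {}")
  case True
  then have "G x \<le> 0" for x using nonpos no_roots by blast
  then show ?thesis by (intro exI[of _ "-1"] exI[of _ 1]) auto
next
  case False
  obtain a \<epsilon> q where *: "sign_fit G a (degree p) \<epsilon> q" "mono_on {a..} G" "\<And>x. x \<ge> a \<Longrightarrow> poly p x \<ge> 0"
    using last_root[OF False] by blast
  have "G x \<le> 0" if "x \<ge> a" for x
    using that *(3) by (intro nonpos) auto
  then have "\<epsilon> * poly q x * G x \<ge> 0" for x
    using * by (intro sign_fit_finish_nonpos) auto
  moreover have "\<epsilon> \<noteq> 0" "lead_coeff q = 1" "degree q \<le> degree p"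
    using *(1) by (auto simp: sign_fit_def)
  ultimately show ?thesis by blast
qed

text \<open>The half line beyond the last root may add one sign change, hence the
  \<open>Suc\<close>. Without roots \<open>G\<close> is monotone on the whole line.\<close>

lemma sign_polynomial_pos:
  assumes pos: "\<And>a. \<exists>x\<ge>a. G x > 0"
  shows "\<exists>q. lead_coeff q = 1 \<and> degree q \<le> Suc (degree p) \<and> (\<forall>x. poly q x * G x \<ge> 0)"
proof (cases "roots = {}")
  case True
  obtain y where y: "G y > 0" using pos by blast
  have mono: "mono_on S G" for S
    using no_roots(2)[OF True] mono_on_subset by blast
  \<comment> \<open>Starting the sweep where \<open>G\<close> is positive forces \<epsilon> to be
    1.\<close>
  obtain \<epsilon> q where fit: "sign_fit G y 1 \<epsilon> q"
    using sign_fit_start[of y G] mono by blast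
  then have "\<epsilon> = 1" and q: "lead_coeff q = 1" "degree q \<le> 1" "\<And>x. x > y \<Longrightarrow> poly q x > 0"
    "\<And>x. x \<le> y \<Longrightarrow> poly q x * G x \<ge> 0"
    using y by (auto simp: sign_fit_def zero_le_mult_iff)
  have "poly q x * G x \<ge> 0" for x
  proof (cases "x \<le> y")
    case False
    then have "G x \<ge> G y" using mono[of UNIV] by (simp add: monotone_on_def)
    then show ?thesis using q(3)[of x] y False by simp
  qed (rule q(4))
  then show ?thesis using q by (intro exI[of _ q]) auto
next
  case False
  obtain a \<epsilon> q where *: "sign_fit G a (degree p) \<epsilon> q" "mono_on {a..} G" "\<And>x. x \<ge> a \<Longrightarrow> poly p x \<ge> 0"
    using last_root[OF False] by blast
  obtain y where "y \<ge> a" "G y > 0" using pos by blast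
  with * show ?thesis using sign_fit_finish_pos by blast
qed

end

section \<open>The skew form of a weight\<close>

lemma borel_poly [measurable]: "poly p \<in> borel_measurable (borel :: real measure)"
  by (intro borel_measurable_continuous_onI continuous_intros)

text \<open>Borel measurability puts the integrands on the product of two \<open>lborel\<close>,
  where Fubini applies; the general weight is reduced to this case at the end.\<close>

locale borel_weight =
  fixes w :: "real \<Rightarrow> real"
  assumes borel [measurable]: "w \<in> borel_measurable borel"
    and nonneg: "w x \<ge> 0"
    and moments: "integrable lborel (\<lambda>x. x ^ n * w x)"
    and nontrivial: "\<not> (AE x in lborel. w x = 0)"
begin

lemma integrable_poly: "integrable lborel (\<lambda>x. poly p x * w x)"
proof -
  have "(\<lambda>x. poly p x * w x) = (\<lambda>x. \<Sum>i\<le>degree p. coeff p i * (x ^ i * w x))"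
    by (simp add: poly_altdef sum_distrib_right mult.assoc)
  then show ?thesis
    using moments by (auto intro!: Bochner_Integration.integrable_sum)
qed

definition moment :: "real poly \<Rightarrow> real" where
  "moment p = (LINT x|lborel. poly p x * w x)"

text \<open>The function \<open>G\<close> of the introduction.\<close>

definition sgn_transform :: "real poly \<Rightarrow> real \<Rightarrow> real" where
  "sgn_transform p y = (LINT x|lborel. sgn (y - x) * (poly p x * w x))"

definition pairing :: "real poly \<Rightarrow> real poly \<Rightarrow> real" where
  "pairing p q = (LINT y|lborel. sgn_transform p y * (poly q y * w y))"

lemma integrable_sgn: "integrable lborel (\<lambda>x. sgn (y - x) * (poly p x * w x))"
  by (rule Bochner_Integration.integrable_bound[OF integrable_poly[of p]])
    (auto simp: abs_mult sgn_real_def)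

lemma integrable_product:
  "integrable (lborel \<Otimes>\<^sub>M lborel) (\<lambda>(x, y). (poly p x * w x) * (poly q y * w y))"
proof (rule lborel_pair.Fubini_integrable)
  show "integrable lborel (\<lambda>x. LINT y|lborel. norm (case (x, y) of (x, y) \<Rightarrow> (poly p x * w x) * (poly q y * w y)))"
    using integrable_norm[OF integrable_poly[of p]]
    by (simp add: abs_mult del: integrable_norm_iff)
qed (use integrable_poly in auto)

text \<open>Serves both the sign kernel and the indicators of the half planes.\<close>

lemma integrable_kernel_product:
  assumes [measurable]: "case_prod K \<in> borel_measurable (lborel \<Otimes>\<^sub>M lborel)"
    and "\<And>x y. \<bar>K x y\<bar> \<le> (1 :: real)"
  shows "integrable (lborel \<Otimes>\<^sub>M lborel) (\<lambda>(x, y). K x y * (poly p x * w x * (poly q y * w y)))"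
proof (rule Bochner_Integration.integrable_bound[OF integrable_product[of p q]])
  show "AE z in lborel \<Otimes>\<^sub>M lborel.
    norm (case z of (x, y) \<Rightarrow> K x y * (poly p x * w x * (poly q y * w y)))
      \<le> norm (case z of (x, y) \<Rightarrow> poly p x * w x * (poly q y * w y))"
    using mult_right_mono[OF assms(2), of "\<bar>poly p x * w x * (poly q y * w y)\<bar>" for x y]
    by (intro AE_I2) (auto simp: abs_mult)
qed measurable

lemma integrable_sgn_product:
  "integrable (lborel \<Otimes>\<^sub>M lborel) (\<lambda>(x, y). sgn (y - x) * (poly p x * w x * (poly q y * w y)))"
  by (rule integrable_kernel_product) (auto simp: sgn_real_def)

lemma sgn_product_section:
  "(LINT x|lborel. sgn (y - x) * (poly p x * w x * (poly q y * w y))) =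
     sgn_transform p y * (poly q y * w y)"
  unfolding sgn_transform_def by (simp add: mult.assoc flip: integral_mult_left_zero)

lemma integrable_pairing: "integrable lborel (\<lambda>y. sgn_transform p y * (poly q y * w y))"
  using lborel_pair.integrable_snd[OF integrable_sgn_product[of p q]]
  by (simp add: sgn_product_section)

lemma pairing_conv_product:
  "pairing p q = integral\<^sup>L (lborel \<Otimes>\<^sub>M lborel) (\<lambda>(x, y). sgn (y - x) * (poly p x * w x * (poly q y * w y)))"
  using lborel_pair.integral_snd[OF integrable_sgn_product[of p q]]
  by (simp add: sgn_product_section pairing_def)

text \<open>Fubini exchanges the variables and the sign kernel is odd.\<close>

lemma pairing_swap: "pairing q p = - pairing p q"
proof -
  have "pairing p q = (LINT x|lborel. LINT y|lborel. sgn (y - x) * (poly p x * w x * (poly q y * w y)))"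
    using lborel_pair.integral_fst[OF integrable_sgn_product[of p q]]
    by (simp add: pairing_conv_product)
  also have "\<dots> = (LINT x|lborel. - (LINT y|lborel. sgn (x - y) * (poly q y * w y * (poly p x * w x))))"
    unfolding Bochner_Integration.integral_minus[symmetric]
    by (intro Bochner_Integration.integral_cong refl) (simp add: sgn_real_def)
  also have "\<dots> = - pairing q p"
    by (simp add: sgn_product_section pairing_def)
  finally show ?thesis by simp
qed

lemma pairing_add: "pairing p (q + r) = pairing p q + pairing p r"
  unfolding pairing_def
  using Bochner_Integration.integral_add[OF integrable_pairing[of p q] integrable_pairing[of p r]]
  by (simp add: distrib_left distrib_right)

lemma pairing_smult: "pairing p (smult c q) = c * pairing p q"
  unfolding pairing_def
  by (simp add: mult_ac flip: integral_mult_right_zero)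

lemma moment_add: "moment (p + q) = moment p + moment q"
  unfolding moment_def
  using Bochner_Integration.integral_add[OF integrable_poly[of p] integrable_poly[of q]]
  by (simp add: distrib_right)

lemma moment_smult: "moment (smult c p) = c * moment p"
  unfolding moment_def by (simp add: mult_ac flip: integral_mult_right_zero)

text \<open>The difference of the two half-plane indicators is \<open>sgn (y - x)\<close>, including
  the value 0 on the diagonal.\<close>

lemma skew_form_eq_pairing: "skew_form w p q = pairing p q"
proof -
  define h where "h = (\<lambda>z :: real \<times> real. poly p (fst z) * poly q (snd z) * w (fst z) * w (snd z))"
  have [measurable]: "h \<in> borel_measurable (lborel \<Otimes>\<^sub>M lborel)"
    unfolding h_def by measurable
  have less_sets: "{(x, y). x < y} \<in> sets (lborel \<Otimes>\<^sub>M (lborel :: real measure))"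
    "{(x, y). x > y} \<in> sets (lborel \<Otimes>\<^sub>M (lborel :: real measure))"
    unfolding lborel_prod case_prod_beta sets_lborel
    by (intro borel_open open_Collect_less continuous_intros)+
  \<comment> \<open>For Borel integrands, completing the measure leaves the integral
    unchanged.\<close>
  have *: "(LINT z:A|lebesgue. h z) = (LINT z|(lborel \<Otimes>\<^sub>M lborel). indicator A z * h z)"
    "integrable (lborel \<Otimes>\<^sub>M lborel) (\<lambda>z. indicator A z * h z)"
    if [measurable]: "A \<in> sets (lborel \<Otimes>\<^sub>M lborel)" for A
  proof -
    have "(\<lambda>z. indicator A z * h z) \<in> borel_measurable (lborel \<Otimes>\<^sub>M lborel)"
      by measurable
    then show "(LINT z:A|lebesgue. h z) = (LINT z|(lborel \<Otimes>\<^sub>M lborel). indicator A z * h z)"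
      unfolding set_lebesgue_integral_def real_scaleR_def lborel_prod
      by (rule integral_completion)
    have "integrable (lborel \<Otimes>\<^sub>M lborel)
      (\<lambda>(x, y). indicator A (x, y) * (poly p x * w x * (poly q y * w y)))"
      by (rule integrable_kernel_product) (auto split: split_indicator)
    then show "integrable (lborel \<Otimes>\<^sub>M lborel) (\<lambda>z. indicator A z * h z)"
      by (simp add: h_def case_prod_unfold mult_ac)
  qed
  have "skew_form w p q =
      (LINT z|(lborel \<Otimes>\<^sub>M lborel). indicator {(x, y). x < y} z * h z - indicator {(x, y). x > y} z * h z)"
    unfolding skew_form_def h_def[symmetric] *(1)[OF less_sets(1)] *(1)[OF less_sets(2)]
    by (rule Bochner_Integration.integral_diff[symmetric]) (intro *(2) less_sets)+
  also have "\<dots> = pairing p q"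
    unfolding pairing_conv_product
    by (intro Bochner_Integration.integral_cong refl)
      (auto simp: h_def case_prod_beta sgn_real_def split: split_indicator)
  finally show ?thesis .
qed

section \<open>Monotonicity, zeros and limit of the transform\<close>

lemma sgn_transform_diff:
  "sgn_transform p y - sgn_transform p x = (LINT t|lborel. (sgn (y - t) - sgn (x - t)) * (poly p t * w t))"
  and integrable_sgn_diff: "integrable lborel (\<lambda>t. (sgn (y - t) - sgn (x - t)) * (poly p t * w t))"
  using Bochner_Integration.integral_diff[OF integrable_sgn[of y p] integrable_sgn[of x p]]
    Bochner_Integration.integrable_diff[OF integrable_sgn[of y p] integrable_sgn[of x p]]
  by (simp_all add: sgn_transform_def left_diff_distrib)

text \<open>For \<open>x < y\<close> the kernel is 2 between the points, 0 outside and 1 at the two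
  end points, which are discarded as null sets.\<close>

lemma AE_sgn_diff_nonneg:
  assumes "x \<le> y" "\<And>t. x < t \<Longrightarrow> t < y \<Longrightarrow> poly p t \<ge> 0"
  shows "AE t in lborel. (sgn (y - t) - sgn (x - t)) * (poly p t * w t) \<ge> 0"
  using AE_lborel_singleton[of x] AE_lborel_singleton[of y]
proof eventually_elim
  case (elim t)
  show ?case
  proof (cases "x < t \<and> t < y")
    case True
    then show ?thesis using assms(2)[of t] nonneg[of t] by (simp add: sgn_real_def)
  next
    case False
    then show ?thesis using elim assms(1) by (auto simp: sgn_real_def)
  qed
qed

lemma sgn_transform_mono:
  assumes "x \<le> y" "\<And>t. x < t \<Longrightarrow> t < y \<Longrightarrow> poly p t \<ge> 0"
  shows "sgn_transform p x \<le> sgn_transform p y"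
  using integral_nonneg_AE[OF AE_sgn_diff_nonneg[OF assms]]
  by (simp flip: sgn_transform_diff)

lemma sgn_transform_uminus: "sgn_transform (- p) x = - sgn_transform p x"
  by (simp add: sgn_transform_def)

text \<open>A nonnegative integrand with zero integral vanishes almost everywhere; between
  \<open>x\<close> and \<open>y\<close> it is \<open>2 * poly p t * w t\<close> with
  \<open>poly p t > 0\<close>.\<close>

lemma AE_weight_zero_nonneg:
  assumes "x < y" "\<And>t. x < t \<Longrightarrow> t < y \<Longrightarrow> poly p t > 0"
    and "sgn_transform p x = sgn_transform p y"
  shows "AE t in lborel. x < t \<longrightarrow> t < y \<longrightarrow> w t = 0"
proof -
  have "AE t in lborel. (sgn (y - t) - sgn (x - t)) * (poly p t * w t) \<ge> 0"
    using assms(1,2) by (intro AE_sgn_diff_nonneg) (auto intro: less_imp_le)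
  then have "AE t in lborel. (sgn (y - t) - sgn (x - t)) * (poly p t * w t) = 0"
    using integral_nonneg_eq_0_iff_AE[OF integrable_sgn_diff[of y x p]] assms(3)
    by (simp flip: sgn_transform_diff)
  then show ?thesis
  proof eventually_elim
    case (elim t)
    then show ?case using assms(2)[of t] by (auto simp: sgn_real_def)
  qed
qed

lemma AE_weight_zero:
  assumes "x < y" "\<And>t. x < t \<Longrightarrow> t < y \<Longrightarrow> poly p t \<noteq> 0"
    and "sgn_transform p x = sgn_transform p y"
  shows "AE t in lborel. x < t \<longrightarrow> t < y \<longrightarrow> w t = 0"
proof -
  have "(\<forall>t\<in>{x<..<y}. poly p t \<ge> 0) \<or> (\<forall>t\<in>{x<..<y}. poly p t \<le> 0)"
    using assms(2) by (intro poly_sign_constant) auto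
  then show ?thesis
  proof
    assume "\<forall>t\<in>{x<..<y}. poly p t \<ge> 0"
    then show ?thesis
      using assms by (intro AE_weight_zero_nonneg[of x y p]) (auto simp: less_le)
  next
    assume "\<forall>t\<in>{x<..<y}. poly p t \<le> 0"
    then show ?thesis
      using assms by (intro AE_weight_zero_nonneg[of x y "- p"])
        (auto simp: less_le sgn_transform_uminus)
  qed
qed

text \<open>Zeros of the transform can fill a set of positive measure, for instance across a gap of
  the weight. Between two zeros with no root of \<open>p\<close> in between, equal values of the
  transform kill \<open>w\<close>.\<close>

lemma AE_sgn_transform_zero:
  assumes "p \<noteq> 0"
  shows "AE x in lborel. sgn_transform p x = 0 \<longrightarrow> w x = 0"
proof -
  define null where "null r s \<longleftrightarrow> (AE t in lborel. r < t \<longrightarrow> t < s \<longrightarrow> w t = 0)" for r s :: real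
  define gap where "gap r s \<longleftrightarrow> (\<forall>t. r < t \<longrightarrow> t < s \<longrightarrow> poly p t \<noteq> 0)" for r s :: real
  define Z where "Z r s = {x. r < x \<and> x < s \<and> sgn_transform p x = 0}" for r s
  \<comment> \<open>Least and greatest elements, if any. A point of \<open>A\<close> outside
    \<open>ends A\<close> has points of \<open>A\<close> on both sides.\<close>
  define ends where "ends A = {x \<in> A. \<forall>y\<in>A. x \<le> y} \<union> {x \<in> A. \<forall>y\<in>A. y \<le> x}" for A :: "real set"
  have "finite {x \<in> A. \<forall>y\<in>A. x \<le> y}" "finite {x \<in> A. \<forall>y\<in>A. y \<le> x}" for A :: "real set"
  proof -
    have "\<forall>u\<in>{x \<in> A. \<forall>y\<in>A. x \<le> y}. \<forall>v\<in>{x \<in> A. \<forall>y\<in>A. x \<le> y}. u = v"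
      "\<forall>u\<in>{x \<in> A. \<forall>y\<in>A. y \<le> x}. \<forall>v\<in>{x \<in> A. \<forall>y\<in>A. y \<le> x}. u = v"
      by (auto intro: antisym)
    then show "finite {x \<in> A. \<forall>y\<in>A. x \<le> y}" "finite {x \<in> A. \<forall>y\<in>A. y \<le> x}"
      by (metis (no_types, lifting) finite.simps finite_subset insertI1 subsetI singletonI)+
  qed
  then have fin: "finite (ends A)" for A by (simp add: ends_def)
  \<comment> \<open>A zero of the transform lying strictly between two others, with no root of \<open>p\<close> nearby, belongs
    to a rational interval on which \<open>w\<close> vanishes almost everywhere; \<open>C\<close> collects the countably
    many exceptions.\<close>
  define C where "C = {x. poly p x = 0} \<union> (\<Union>(r, s) \<in> UNIV :: (rat \<times> rat) set. ends (Z (of_rat r) (of_rat s)))"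
  have "countable C"
    unfolding C_def using poly_roots_finite[OF assms] fin
    by (intro countable_Un countable_UN) (auto intro: countable_finite)
  then have "AE x in lborel. x \<notin> C"
    by (intro AE_not_in countable_imp_null_set_lborel)
  \<comment> \<open>Countability of the rational intervals allows one exceptional null set for all
    of them, so the property can be used at a single point \<open>x\<close>.\<close>
  moreover have "AE t in lborel. \<forall>rs :: rat \<times> rat. null (of_rat (fst rs)) (of_rat (snd rs)) \<longrightarrow>
      of_rat (fst rs) < t \<longrightarrow> t < of_rat (snd rs) \<longrightarrow> w t = 0"
    unfolding AE_all_countable by (auto simp: null_def)
  ultimately show ?thesis
  proof eventually_elim
    case (elim x)
    show ?case
    proof
      assume x: "sgn_transform p x = 0"
      have "x \<notin> {x. poly p x = 0}" using elim(1) by (auto simp: C_def)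
      moreover have "open (- {x. poly p x = 0})"
        using poly_roots_finite[OF assms] by (simp add: open_Compl finite_imp_closed)
      ultimately obtain e where e: "e > 0" "\<And>t. \<bar>t - x\<bar> < e \<Longrightarrow> poly p t \<noteq> 0"
        by (auto simp: open_dist dist_real_def)
      obtain r where r: "x - e < of_rat r" "of_rat r < x" using of_rat_dense[of "x - e" x] e by auto
      obtain s where s: "x < of_rat s" "of_rat s < x + e" using of_rat_dense[of x "x + e"] e by auto
      define A where "A = Z (of_rat r) (of_rat s)"
      have "x \<in> A" using r s x by (simp add: A_def Z_def)
      moreover have "x \<notin> ends A" using elim(1) by (auto simp: C_def A_def)
      ultimately obtain y z where yz: "y \<in> A" "y < x" "z \<in> A" "x < z"
        by (auto simp: ends_def not_le)
      have "null y z"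
        unfolding null_def
      proof (rule AE_weight_zero)
        show "poly p t \<noteq> 0" if "y < t" "t < z" for t
          using that yz r s by (intro e) (auto simp: A_def Z_def)
      qed (use yz in \<open>auto simp: A_def Z_def\<close>)
      \<comment> \<open>Shrinks the interval to rational end points that still enclose
        \<open>x\<close>.\<close>
      obtain r' where r': "y < of_rat r'" "of_rat r' < x" using of_rat_dense[of y x] yz by auto
      obtain s' where s': "x < of_rat s'" "of_rat s' < z" using of_rat_dense[of x z] yz by auto
      have "null (of_rat r') (of_rat s')"
        using \<open>null y z\<close> r' s' unfolding null_def by (auto elim!: eventually_mono)
      then show "w x = 0"
        using elim(2)[rule_format, of "(r', s')"] r' s' by simp
    qed
  qed
qed

text \<open>The integrand has one sign. A zero integral would make \<open>w\<close> vanish almost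
  everywhere: off the finitely many roots of \<open>q\<close>, and almost everywhere on the zeros of
  the transform.\<close>

lemma pairing_pos:
  assumes "p \<noteq> 0" "q \<noteq> 0" and sign: "\<And>x. \<epsilon> * poly q x * sgn_transform p x \<ge> 0" and "\<epsilon> \<noteq> 0"
  shows "\<epsilon> * pairing p q > 0"
proof -
  define h where "h y = \<epsilon> * (sgn_transform p y * (poly q y * w y))" for y
  have int: "integrable lborel h" and eq: "(LINT y|lborel. h y) = \<epsilon> * pairing p q"
    unfolding h_def pairing_def using integrable_pairing[of p q] by simp_all
  have h: "h y \<ge> 0" for y
    using mult_nonneg_nonneg[OF sign[of y] nonneg[of y]] by (simp add: h_def mult_ac)
  have "(LINT y|lborel. h y) \<noteq> 0"
  proof
    assume "(LINT y|lborel. h y) = 0"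
    then have "AE y in lborel. h y = 0"
      using integral_nonneg_eq_0_iff_AE[OF int] h by simp
    moreover have "AE y in lborel. y \<notin> {y. poly q y = 0}"
      by (intro AE_not_in finite_imp_null_set_lborel poly_roots_finite assms)
    ultimately have "AE y in lborel. w y = 0"
      using AE_sgn_transform_zero[OF assms(1)]
      by eventually_elim (use \<open>\<epsilon> \<noteq> 0\<close> in \<open>auto simp: h_def\<close>)
    with nontrivial show False ..
  qed
  moreover have "(LINT y|lborel. h y) \<ge> 0"
    using h by simp
  ultimately show ?thesis unfolding eq by linarith
qed

text \<open>Left of \<open>x\<close> the integrands agree; right of \<open>x\<close> the kernel -1
  only lowers a nonnegative integrand.\<close>

lemma sgn_transform_le_moment:
  assumes "\<And>t. t > x \<Longrightarrow> poly p t \<ge> 0"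
  shows "sgn_transform p x \<le> moment p"
  unfolding sgn_transform_def moment_def
proof (rule integral_mono_AE[OF integrable_sgn integrable_poly])
  show "AE t in lborel. sgn (x - t) * (poly p t * w t) \<le> poly p t * w t"
    using AE_lborel_singleton[of x]
  proof eventually_elim
    case (elim t)
    then show ?case
      using assms[of t] nonneg[of t] by (auto simp: sgn_real_def)
  qed
qed

lemma sgn_transform_tendsto: "(\<lambda>n. sgn_transform p (real n)) \<longlonglongrightarrow> moment p"
  unfolding sgn_transform_def moment_def
proof (rule integral_dominated_convergence[where w = "\<lambda>x. \<bar>poly p x * w x\<bar>"])
  show "AE x in lborel. (\<lambda>n. sgn (real n - x) * (poly p x * w x)) \<longlonglongrightarrow> poly p x * w x"
  proof (rule AE_I2)
    fix x :: real
    have "eventually (\<lambda>n. real n > x) sequentially"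
      using filterlim_real_sequentially unfolding filterlim_at_top_dense by blast
    then have "eventually (\<lambda>n. sgn (real n - x) * (poly p x * w x) = poly p x * w x) sequentially"
      by eventually_elim simp
    then show "(\<lambda>n. sgn (real n - x) * (poly p x * w x)) \<longlonglongrightarrow> poly p x * w x"
      by (rule tendsto_eventually)
  qed
  show "AE x in lborel. norm (sgn (real n - x) * (poly p x * w x)) \<le> \<bar>poly p x * w x\<bar>" for n
    by (auto simp: abs_mult sgn_real_def)
qed (use integrable_poly in \<open>auto intro: integrable_abs\<close>)

lemma sign_driven_sgn_transform:
  assumes "lead_coeff p = 1"
  shows "sign_driven p (sgn_transform p)"
proof
  fix x y :: real
  assume xy: "x < y"
  show "sgn_transform p x \<le> sgn_transform p y" if "\<And>t. x < t \<Longrightarrow> t < y \<Longrightarrow> poly p t \<ge> 0"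
    using xy that by (intro sgn_transform_mono) auto
  show "sgn_transform p y \<le> sgn_transform p x" if "\<And>t. x < t \<Longrightarrow> t < y \<Longrightarrow> poly p t \<le> 0"
    using sgn_transform_mono[of x y "- p"] xy that by (simp add: sgn_transform_uminus)
qed (rule assms)

sublocale skew_moment pairing moment
proof
  fix p :: "real poly"
  assume p: "lead_coeff p = 1"
  then interpret sign_driven p "sgn_transform p"
    by (rule sign_driven_sgn_transform)
  {
    assume "moment p \<le> 0"
    then have "sgn_transform p x \<le> 0" if "\<And>t. t > x \<Longrightarrow> poly p t \<ge> 0" for x
      using sgn_transform_le_moment[of x p] that by fastforce
    from sign_polynomial_nonpos[OF this] obtain \<epsilon> q where q: "lead_coeff q = 1" "degree q \<le> degree p"
      "\<And>x. \<epsilon> * poly q x * sgn_transform p x \<ge> 0" "\<epsilon> \<noteq> 0"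
      by blast
    from q(1) have "q \<noteq> 0" by auto
    then have "\<epsilon> * pairing p q > 0"
      using q by (intro pairing_pos) auto
    then show "\<exists>q. degree q \<le> degree p \<and> pairing p q \<noteq> 0"
      using q by (intro exI[of _ q]) auto
  next
    assume pos: "moment p > 0"
    \<comment> \<open>The transform tends to the positive moment along the integers.\<close>
    have "\<exists>x\<ge>a. sgn_transform p x > 0" for a
    proof -
      have "eventually (\<lambda>n. sgn_transform p (real n) > 0) sequentially"
        using order_tendstoD(1)[OF sgn_transform_tendsto pos] .
      moreover have "eventually (\<lambda>n. real n \<ge> a) sequentially"
        using eventually_ge_at_top[of "nat \<lceil>a\<rceil>"] by eventually_elim linarith
      ultimately have "eventually (\<lambda>n. real n \<ge> a \<and> sgn_transform p (real n) > 0) sequentially"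
        by eventually_elim simp
      then show ?thesis
        by (auto simp: eventually_sequentially)
    qed
    from sign_polynomial_pos[OF this] obtain q where q: "lead_coeff q = 1" "degree q \<le> Suc (degree p)"
      "\<And>x. poly q x * sgn_transform p x \<ge> 0"
      by blast
    from q(1) have "q \<noteq> 0" by auto
    then have "1 * pairing p q > 0"
      using q by (intro pairing_pos) auto
    then show "\<exists>q. degree q \<le> Suc (degree p) \<and> lead_coeff q = 1 \<and> pairing p q > 0"
      using q by (intro exI[of _ q]) auto
  }
qed (rule pairing_add pairing_smult pairing_swap moment_add moment_smult)+

end

section \<open>Passage to Lebesgue measurable weights\<close>

lemma borel_imp_lebesgue_measurable:
  fixes f :: "'a::euclidean_space \<Rightarrow> real"
  assumes "f \<in> borel_measurable borel"
  shows "f \<in> borel_measurable lebesgue"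
  by (rule measurable_completion) (simp add: assms)

text \<open>Completeness of Lebesgue measure supplies the measurability of \<open>g\<close>.\<close>

lemma integral_lebesgue_cong_AE:
  fixes f g :: "'a::euclidean_space \<Rightarrow> real"
  assumes f: "f \<in> borel_measurable borel" and AE: "AE x in lebesgue. f x = g x"
  shows "(LINT x|lebesgue. f x) = (LINT x|lebesgue. g x)"
proof -
  note f' = borel_imp_lebesgue_measurable[OF f]
  show ?thesis
    by (rule integral_cong_AE[OF f' borel_measurable_AE[OF f' AE] AE])
qed

text \<open>A null set \<open>N\<close> on the line gives the null strips
  \<open>N \<times> UNIV\<close> and \<open>UNIV \<times> N\<close> in the plane, outside which both
  weight factors agree.\<close>

lemma skew_form_cong_AE:
  assumes [measurable]: "v \<in> borel_measurable borel" and AE: "AE x in lborel. v x = w x"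
  shows "skew_form v p q = skew_form w p q"
proof -
  obtain N :: "real set" where N: "N \<in> null_sets lborel" "{x. v x \<noteq> w x} \<subseteq> N"
    using AE unfolding eventually_ae_filter by auto
  have N2: "N \<times> UNIV \<in> null_sets (lborel \<Otimes>\<^sub>M (lborel :: real measure))"
    "UNIV \<times> N \<in> null_sets ((lborel :: real measure) \<Otimes>\<^sub>M lborel)"
    using N(1) by (auto intro: lborel.times_in_null_sets1 lborel.times_in_null_sets2)
  have "AE z in lborel \<Otimes>\<^sub>M (lborel :: real measure). v (fst z) = w (fst z) \<and> v (snd z) = w (snd z)"
    using N2[THEN AE_not_in]
  proof eventually_elim
    case (elim z)
    then show ?case using N(2) by (cases z) auto
  qed
  then have *: "AE z in lebesgue. v (fst z) = w (fst z) \<and> v (snd z) = w (snd z)"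
    unfolding lborel_prod by (rule AE_completion)
  have "(LINT z:A|lebesgue. poly p (fst z) * poly q (snd z) * v (fst z) * v (snd z)) =
        (LINT z:A|lebesgue. poly p (fst z) * poly q (snd z) * w (fst z) * w (snd z))"
    if "A \<in> sets borel" for A :: "(real \<times> real) set"
    unfolding set_lebesgue_integral_def
  proof (rule integral_lebesgue_cong_AE)
    have [measurable]: "A \<in> sets (borel \<Otimes>\<^sub>M borel)"
      using that by (simp only: borel_prod)
    show "(\<lambda>z. indicator A z *\<^sub>R (poly p (fst z) * poly q (snd z) * v (fst z) * v (snd z)))
        \<in> borel_measurable borel"
      unfolding borel_prod[symmetric] by measurable
    show "AE z in lebesgue. indicator A z *\<^sub>R (poly p (fst z) * poly q (snd z) * v (fst z) * v (snd z)) =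
        indicator A z *\<^sub>R (poly p (fst z) * poly q (snd z) * w (fst z) * w (snd z))"
      using * by eventually_elim simp
  qed
  moreover have "{(x, y :: real). x < y} \<in> sets borel" "{(x, y :: real). x > y} \<in> sets borel"
    unfolding case_prod_beta by (intro borel_open open_Collect_less continuous_intros)+
  ultimately show ?thesis
    unfolding skew_form_def by presburger
qed

theorem proposition3p4:
  fixes w :: "real \<Rightarrow> real"
  assumes nonneg: "\<And>x. w x \<ge> 0"
    and moments: "\<And>n::nat. integrable lebesgue (\<lambda>x. x ^ n * w x)"
    and pos: "(LINT x|lebesgue. w x) > 0"
  shows "\<exists>!\<phi> :: nat \<Rightarrow> real poly.
    (\<forall>i. degree (\<phi> i) = i \<and> lead_coeff (\<phi> i) = 1) \<and>
    (\<exists>(\<sigma> :: nat \<Rightarrow> real) (\<gamma> :: nat \<Rightarrow> real).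
       (\<forall>k. \<sigma> k > 0) \<and>
       (\<forall>i. even i \<longrightarrow> \<gamma> i > 0) \<and>
       (\<forall>k. skew_form w (\<phi> (2 * k)) (\<phi> (2 * k + 1)) = \<sigma> k) \<and>
       (\<forall>k. skew_form w (\<phi> (2 * k + 1)) (\<phi> (2 * k)) = - \<sigma> k) \<and>
       (\<forall>i j. (\<nexists>k. (i, j) = (2 * k, 2 * k + 1) \<or> (i, j) = (2 * k + 1, 2 * k)) \<longrightarrow>
          skew_form w (\<phi> i) (\<phi> j) = 0) \<and>
       (\<forall>i. (LINT x|lebesgue. poly (\<phi> i) x * w x) = (if even i then \<gamma> i else 0)))"
proof -
  \<comment> \<open>Measurability of the weight is contained in integrability of its zeroth
    moment.\<close>
  have meas: "w \<in> borel_measurable lebesgue"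
    using borel_measurable_integrable[OF moments[of 0]] by simp
  then obtain v0 where v0: "v0 \<in> borel_measurable lborel" "AE x in lborel. w x = v0 x"
    using completion_ex_borel_measurable_real by blast
  \<comment> \<open>A Borel representative is nonnegative only almost everywhere; truncation makes
    it nonnegative everywhere, as \<open>borel_weight\<close> demands.\<close>
  define v where "v x = max 0 (v0 x)" for x
  have v_meas: "v \<in> borel_measurable borel"
    using v0(1) unfolding v_def by simp
  have AE: "AE x in lborel. w x = v x"
    using v0(2)
  proof eventually_elim
    case (elim x)
    then show ?case using nonneg[of x] by (simp add: v_def)
  qed
  then have AE': "AE x in lebesgue. v x = w x"
    by (intro AE_completion) (simp add: eq_commute)
  have fv: "(\<lambda>x. f x * v x) \<in> borel_measurable borel"
    "AE x in lebesgue. f x * v x = f x * w x" if "f \<in> borel_measurable borel" for f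
    using that v_meas AE' by auto
  have int: "integrable lborel (\<lambda>x. x ^ n * v x)" for n
  proof -
    have n: "(\<lambda>x :: real. x ^ n) \<in> borel_measurable borel" by measurable
    have "integrable lebesgue (\<lambda>x. x ^ n * v x)"
      by (rule integrable_cong_AE_imp[OF moments[of n]])
        (use fv[OF n] in \<open>auto intro: borel_imp_lebesgue_measurable borel_measurable_integrable moments\<close>)
    then show ?thesis
      using fv(1)[OF n] by (subst (asm) integrable_completion) auto
  qed
  have LINT: "(LINT x|lebesgue. f x * w x) = (LINT x|lborel. f x * v x)"
    if f: "f \<in> borel_measurable borel" for f
    using integral_lebesgue_cong_AE[OF fv[OF f]] integral_completion[of "\<lambda>x. f x * v x" lborel] fv(1)[OF f]
    by simp
  interpret borel_weight v
  proof
    show "\<not> (AE x in lborel. v x = 0)"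
    proof
      assume "AE x in lborel. v x = 0"
      then have "(LINT x|lborel. v x) = 0"
        by (rule integral_eq_zero_AE)
      with LINT[of "\<lambda>_. 1"] pos show False by simp
    qed
  qed (use v_meas int in \<open>auto simp: v_def\<close>)
  have skew: "skew_form w p q = pairing p q" for p q
    using skew_form_cong_AE[OF v_meas, of w] AE' skew_form_eq_pairing by (simp add: AE_completion_iff eq_commute)
  have L: "(LINT x|lebesgue. poly p x * w x) = moment p" for p
    using LINT[OF borel_poly] by (simp add: moment_def)
  show ?thesis
    unfolding skew L skew_orthogonal_family_iff by (rule skew_orthogonal_family_ex1)
qed

end
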